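(* Let $q$ be a prime power and $t\ge 2$. Assume $V(2t,q)$ has a vector space partition into $q^t+1-a$ subspaces of dimension $t$ and $m_d$ subspaces of dimension $d$ for $d=1,2,\ldots,t-1$. For each $d$ let \[ \mu_d=\max\Big(\{0,1,\ldots,m_d\}\cap\Big[0,\tfrac{q^t-1}{q^{t-d}-1}\Big)\Big). \] Then \[ a\ge\max_{\substack{d\in\{1,\ldots,t-1\}\\ x\in\{1,\ldots,\mu_d\}}}\big(x-\mathrm{R}_q(t,d,x)\big), \] where $\mathrm{R}_q(t,d,m):=m(m-1)\,\dfrac{\tfrac12(q^{2t-2d}-1)+1-q^{t-d}}{q^t-1-m(q^{t-d}-1)}$.
   Context: A vector space partition of $V(n,q)$ (the $n$-dimensional vector space over $\mathrm{GF}(q)$) is a collection of subspaces, all of positive dimension, such that every nonzero vector lies in exactly one member. *)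

theory Defs
  imports "HOL-Analysis.Cartesian_Space" "HOL-Number_Theory.Prime_Powers"
begin

text \<open>The space $V(n,q)$ is modelled as \<^typ>\<open>'k ^ 'n\<close>, where \<open>'k\<close> is a
  finite field with $q$ elements and the index type \<open>'n\<close> has $n$ elements.\<close>

definition vector_space_partition :: "('k::field ^ 'n) set set \<Rightarrow> bool" where
  "vector_space_partition P \<longleftrightarrow>
     (\<forall>U\<in>P. vec.subspace U \<and> vec.dim U > 0) \<and>
     (\<forall>v. v \<noteq> 0 \<longrightarrow> (\<exists>!U. U \<in> P \<and> v \<in> U))"

definition mu :: "nat \<Rightarrow> nat \<Rightarrow> (nat \<Rightarrow> nat) \<Rightarrow> nat \<Rightarrow> nat" where
  "mu q t m d =
     Max ({0..m d} \<inter> {x. real x \<in> {0..<(real q ^ t - 1) / (real q ^ (t - d) - 1)}})"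

definition R :: "nat \<Rightarrow> nat \<Rightarrow> nat \<Rightarrow> nat \<Rightarrow> real" where
  "R q t d m =
     real m * (real m - 1) *
       ((1 / 2 * (real q ^ (2 * t - 2 * d) - 1) + 1 - real q ^ (t - d)) /
        (real q ^ t - 1 - real m * (real q ^ (t - d) - 1)))"

end

theory Submission
  imports Defs
begin

text \<open>Pass to annihilators. Those of the $t$-dimensional members meet pairwise only in $0$,
  hence miss exactly $a(q^t-1)$ nonzero functionals. Each annihilator of a $d$-dimensional member
  contains $q^t-1+(a-1)(q^{t-d}-1)$ of these, and two such annihilators share at most
  $q^{2t-2d}-1$ of them. Bonferroni's inequality for the annihilators of $x$ such members,
  solved for $a$, is the claim.\<close>

section \<open>The dot product, annihilators and kernels of functionals\<close>

definition dotp :: "('k::field ^ 'n::finite) \<Rightarrow> 'k ^ 'n \<Rightarrow> 'k" where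
  "dotp u w = (\<Sum>i\<in>UNIV. u $ i * w $ i)"

text \<open>Functionals are represented by vectors through \<open>dotp\<close>, so an annihilator
  lives in the same type as the subspace. It may meet that subspace nontrivially, since nonzero
  vectors can be orthogonal to themselves; the argument only uses sizes of annihilators and of their
  intersections.\<close>

definition annihilator :: "('k::field ^ 'n::finite) set \<Rightarrow> ('k ^ 'n) set" where
  "annihilator U = {w. \<forall>u\<in>U. dotp u w = 0}"

lemma dotp_add_left: "dotp (u + v) w = dotp u w + dotp v w"
  by (simp add: dotp_def distrib_right sum.distrib)

lemma dotp_scale_left: "dotp (c *s u) w = c * dotp u w"
  by (simp add: dotp_def sum_distrib_left mult.assoc)

lemma dotp_diff_left: "dotp (u - v) w = dotp u w - dotp v w"
  by (simp add: dotp_def left_diff_distrib sum_subtractf)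

lemma dotp_commute: "dotp u w = dotp w u"
  by (simp add: dotp_def mult.commute)

lemma dotp_zero [simp]: "dotp 0 w = 0" "dotp u 0 = 0"
  by (simp_all add: dotp_def)

lemma exists_dotp_nonzero:
  fixes u :: "'k::field ^ 'n::finite"
  assumes "u \<noteq> 0"
  shows "\<exists>w. dotp w u \<noteq> 0"
proof -
  obtain i where "u $ i \<noteq> 0"
    using assms by (auto simp: vec_eq_iff)
  moreover have "dotp (axis i 1) u = u $ i"
    by (simp add: dotp_def axis_def if_distrib[where f = "\<lambda>x. x * _"] cong: if_cong)
  ultimately show ?thesis by metis
qed

lemma zero_in_annihilator [simp]: "0 \<in> annihilator U"
  by (simp add: annihilator_def)

text \<open>The translates of the kernel by the multiples of \<open>u0\<close> tile
  \<open>U\<close>, one translate for each scalar. The scalar belonging to \<open>v\<close> is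
  recovered by applying the functional, which gives the inverse map.\<close>

lemma card_kernel_on_subspace:
  fixes U :: "('k::{field,finite} ^ 'n::finite) set"
  assumes U: "vec.subspace U" and u0: "u0 \<in> U" "dotp u0 w \<noteq> 0"
  shows "CARD('k) * card {u \<in> U. dotp u w = 0} = card U"
proof -
  let ?K = "{u \<in> U. dotp u w = 0}"
  have "bij_betw (\<lambda>(c, u). u + c *s u0) (UNIV \<times> ?K) U"
  proof (rule bij_betw_byWitness
      [where f' = "\<lambda>v. (dotp v w / dotp u0 w, v - (dotp v w / dotp u0 w) *s u0)"])
    show "\<forall>p \<in> UNIV \<times> ?K. (\<lambda>v. (dotp v w / dotp u0 w, v - (dotp v w / dotp u0 w) *s u0))
        ((\<lambda>(c, u). u + c *s u0) p) = p"
      using u0 by (auto simp: dotp_add_left dotp_scale_left)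
    show "(\<lambda>(c, u). u + c *s u0) ` (UNIV \<times> ?K) \<subseteq> U"
      using U u0 by (auto intro!: vec.subspace_add vec.subspace_scale)
    show "(\<lambda>v. (dotp v w / dotp u0 w, v - (dotp v w / dotp u0 w) *s u0)) ` U \<subseteq> UNIV \<times> ?K"
      using U u0 by (auto simp: dotp_diff_left dotp_scale_left
          intro!: vec.subspace_diff vec.subspace_scale)
  qed auto
  from bij_betw_same_card[OF this] show ?thesis
    by (simp add: card_cartesian_product)
qed

section \<open>Sizes of subspaces, annihilators and their intersections\<close>

lemma card_field_ge_2: "2 \<le> CARD('k::{field,finite})"
proof -
  have "card {0, 1 :: 'k} \<le> CARD('k)" by (intro card_mono) auto
  then show ?thesis by simp
qed

text \<open>Double counting of the pairs \<open>(u, w)\<close> with \<open>dotp u w = 0\<close>. A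
  functional outside the annihilator kills a fraction 1/q of \<open>U\<close>, and a nonzero
  \<open>u\<close> is killed by a fraction 1/q of all functionals. Both counts are multiplied by q
  to avoid division.\<close>

lemma card_subspace_mult_card_annihilator:
  fixes U :: "('k::{field,finite} ^ 'n::finite) set"
  assumes U: "vec.subspace U"
  shows "card U * card (annihilator U) = CARD('k) ^ CARD('n)"
proof -
  define q where "q = real CARD('k)"
  define N where "N = real CARD('k ^ 'n)"
  define A where "A = annihilator U"
  have "(\<Sum>w\<in>UNIV. card {u \<in> U. dotp u w = 0}) = (\<Sum>u\<in>U. card {w. dotp u w = 0})"
    using sum.swap_restrict[of UNIV U "\<lambda>_ _. 1::nat" "\<lambda>w u. dotp u w = 0"] by simp
  then have swap: "(\<Sum>w\<in>UNIV. q * real (card {u \<in> U. dotp u w = 0}))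
      = (\<Sum>u\<in>U. q * real (card {w. dotp u w = 0}))"
    by (simp flip: sum_distrib_left of_nat_sum)
  have L1: "q * real (card {u \<in> U. dotp u w = 0}) = q * card U" if "w \<in> A" for w
  proof -
    have "{u \<in> U. dotp u w = 0} = U"
      using that by (auto simp: A_def annihilator_def)
    then show ?thesis by simp
  qed
  have L2: "q * real (card {u \<in> U. dotp u w = 0}) = card U" if w: "w \<in> - A" for w
  proof -
    obtain u0 where "u0 \<in> U" "dotp u0 w \<noteq> 0"
      using w by (auto simp: A_def annihilator_def)
    from card_kernel_on_subspace[OF U this] show ?thesis
      unfolding q_def by (simp flip: of_nat_mult)
  qed
  have "(\<Sum>w\<in>UNIV. q * real (card {u \<in> U. dotp u w = 0}))
      = (\<Sum>w\<in>A. q * real (card {u \<in> U. dotp u w = 0}))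
        + (\<Sum>w\<in>- A. q * real (card {u \<in> U. dotp u w = 0}))"
    using sum.subset_diff[of A UNIV] by (simp add: Compl_eq_Diff_UNIV add.commute)
  also have "\<dots> = card A * (q * card U) + card (- A) * real (card U)"
    by (simp add: L1 L2)
  also have "real (card (- A)) = N - card A"
    by (simp add: N_def Compl_eq_Diff_UNIV card_Diff_subset card_mono of_nat_diff del: CARD_vec)
  finally have L: "(\<Sum>w\<in>UNIV. q * real (card {u \<in> U. dotp u w = 0}))
      = card A * (q * card U) + (N - card A) * card U" .
  \<comment> \<open>By symmetry of \<open>dotp\<close> the vector \<open>u\<close> now acts as the
    functional, on the whole space.\<close>
  have R2: "q * real (card {w. dotp u w = 0}) = N" if u: "u \<in> U - {0}" for u
  proof -
    obtain w where "dotp w u \<noteq> 0"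
      using u exists_dotp_nonzero by auto
    from card_kernel_on_subspace[OF vec.subspace_UNIV UNIV_I this]
    have "CARD('k) * card {w. dotp u w = 0} = CARD('k ^ 'n)"
      by (simp add: dotp_commute[of _ u] del: CARD_vec)
    then show ?thesis
      unfolding q_def N_def by (simp flip: of_nat_mult del: CARD_vec)
  qed
  have "0 \<in> U" using U by (rule vec.subspace_0)
  then have "card U > 0" by (auto simp: card_gt_0_iff)
  have "(\<Sum>u\<in>U. q * real (card {w. dotp u w = 0}))
      = q * real (card {w :: 'k ^ 'n. dotp 0 w = 0})
        + (\<Sum>u\<in>U - {0}. q * real (card {w. dotp u w = 0}))"
    using \<open>0 \<in> U\<close> by (simp add: sum.remove)
  also have "\<dots> = q * N + (real (card U) - 1) * N"
    using \<open>0 \<in> U\<close> \<open>card U > 0\<close> by (simp add: R2 N_def card_Diff_singleton of_nat_diff)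
  finally have "card A * (q * card U) + (N - card A) * card U = q * N + (real (card U) - 1) * N"
    using swap L by simp
  \<comment> \<open>The terms N * |U| cancel, and what remains on each side is a multiple of q -
    1.\<close>
  then have "(q - 1) * (real (card U) * real (card A)) = (q - 1) * N"
    by (simp add: algebra_simps)
  moreover have "q - 1 \<noteq> 0"
    using card_field_ge_2[where 'k = 'k] by (simp add: q_def)
  ultimately have "real (card U * card A) = N" by simp
  then show ?thesis unfolding A_def N_def by (metis CARD_vec of_nat_eq_iff)
qed

text \<open>A new basis vector \<open>b\<close> multiplies the size by q, because every vector of
  the larger span is u + c b for exactly one scalar c and one u in the old span.\<close>

lemma card_span_independent:
  fixes B :: "('k::{field,finite} ^ 'n::finite) set"
  assumes "vec.independent B"
  shows "card (vec.span B) = CARD('k) ^ card B"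
  using finite[of B] assms
proof (induction B rule: finite_induct)
  case empty
  then show ?case by simp
next
  case (insert b B)
  have b: "b \<notin> vec.span B" and B: "vec.independent B"
    using insert by (auto simp: vec.independent_insert)
  have "bij_betw (\<lambda>(c, u). u + c *s b) (UNIV \<times> vec.span B) (vec.span (insert b B))"
    unfolding bij_betw_def
  proof
    show "inj_on (\<lambda>(c, u). u + c *s b) (UNIV \<times> vec.span B)"
    proof (rule inj_onI, clarsimp)
      fix c u c' u'
      assume uu: "u \<in> vec.span B" "u' \<in> vec.span B" and eq: "u + c *s b = u' + c' *s b"
      have "(c - c') *s b = u' - u"
        using eq by (simp add: vec.scale_left_diff_distrib algebra_simps)
      then have "(c - c') *s b \<in> vec.span B"
        using uu by (simp add: vec.span_diff)
      \<comment> \<open>Otherwise dividing by c - c' would put \<open>b\<close> into the span of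
        \<open>B\<close>.\<close>
      then have "c = c'"
        using b vec.span_scale[of "(c - c') *s b" B "inverse (c - c')"] by (cases "c = c'") auto
      with eq show "c = c' \<and> u = u'" by simp
    qed
    show "(\<lambda>(c, u). u + c *s b) ` (UNIV \<times> vec.span B) = vec.span (insert b B)"
    proof (intro equalityI subsetI)
      fix v assume "v \<in> vec.span (insert b B)"
      then obtain k where "v - k *s b \<in> vec.span B"
        by (auto simp: vec.span_breakdown_eq)
      then show "v \<in> (\<lambda>(c, u). u + c *s b) ` (UNIV \<times> vec.span B)"
        by (intro image_eqI[where x = "(k, v - k *s b)"]) auto
    qed (auto intro!: vec.span_add vec.span_scale intro: vec.span_base vec.span_mono[THEN subsetD])
  qed
  from bij_betw_same_card[OF this] show ?case
    using insert B by (simp add: card_cartesian_product)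
qed

lemma card_subspace_eq_power_dim:
  fixes U :: "('k::{field,finite} ^ 'n::finite) set"
  assumes "vec.subspace U"
  shows "card U = CARD('k) ^ vec.dim U"
proof -
  obtain B where "B \<subseteq> U" "vec.independent B" "U \<subseteq> vec.span B" "card B = vec.dim U"
    using vec.basis_exists by blast
  moreover from this have "vec.span B = U"
    using assms by (meson vec.span_minimal subset_antisym)
  ultimately show ?thesis
    using card_span_independent by metis
qed

lemma card_annihilator:
  fixes U :: "('k::{field,finite} ^ 'n::finite) set"
  assumes "vec.subspace U" "vec.dim U \<le> CARD('n)"
  shows "card (annihilator U) = CARD('k) ^ (CARD('n) - vec.dim U)"
proof -
  have "CARD('k) ^ vec.dim U * card (annihilator U)
      = CARD('k) ^ vec.dim U * CARD('k) ^ (CARD('n) - vec.dim U)"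
    using card_subspace_mult_card_annihilator[OF assms(1)] assms
    by (simp add: card_subspace_eq_power_dim flip: power_add)
  then show ?thesis by simp
qed

text \<open>The functionals vanishing on both subspaces are those vanishing on their sum. The sum is
  direct, so its size is the product of the two sizes.\<close>

lemma card_annihilator_Int:
  fixes U W :: "('k::{field,finite} ^ 'n::finite) set"
  assumes U: "vec.subspace U" and W: "vec.subspace W" and UW: "U \<inter> W = {0}"
    and le: "vec.dim U + vec.dim W \<le> CARD('n)"
  shows "card (annihilator U \<inter> annihilator W) = CARD('k) ^ (CARD('n) - (vec.dim U + vec.dim W))"
proof -
  let ?S = "{u + w |u w. u \<in> U \<and> w \<in> W}"
  have S: "vec.subspace ?S" using vec.subspace_sums[OF U W] .
  have "inj_on (\<lambda>(u, w). u + w) (U \<times> W)"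
  proof (rule inj_onI, clarsimp)
    fix u w u' w'
    assume *: "u \<in> U" "w \<in> W" "u' \<in> U" "w' \<in> W" "u + w = u' + w'"
    then have "u - u' = w' - w" by (simp add: algebra_simps)
    moreover have "u - u' \<in> U" "w' - w \<in> W"
      using * U W by (simp_all add: vec.subspace_diff)
    ultimately have "u - u' \<in> U \<inter> W" by simp
    with UW * show "u = u' \<and> w = w'" by simp
  qed
  moreover have "?S = (\<lambda>(u, w). u + w) ` (U \<times> W)" by auto
  ultimately have "card ?S = card U * card W"
    by (simp add: card_image card_cartesian_product)
  then have cS: "card ?S = CARD('k) ^ (vec.dim U + vec.dim W)"
    by (simp add: card_subspace_eq_power_dim U W power_add)
  have "annihilator U \<inter> annihilator W = annihilator ?S"
  proof (intro equalityI subsetI)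
    fix z assume z: "z \<in> annihilator ?S"
    have "u \<in> ?S" if "u \<in> U" for u
      using that vec.subspace_0[OF W] by force
    moreover have "w \<in> ?S" if "w \<in> W" for w
      using that vec.subspace_0[OF U] by force
    ultimately show "z \<in> annihilator U \<inter> annihilator W"
      using z unfolding annihilator_def by blast
  qed (auto simp: annihilator_def dotp_add_left)
  moreover have "CARD('k) ^ (vec.dim U + vec.dim W) * card (annihilator ?S)
      = CARD('k) ^ (vec.dim U + vec.dim W) * CARD('k) ^ (CARD('n) - (vec.dim U + vec.dim W))"
    using card_subspace_mult_card_annihilator[OF S] le unfolding cS by (simp flip: power_add)
  ultimately show ?thesis by simp
qed

section \<open>Bonferroni's inequality with a uniform bound on pairwise intersections\<close>

lemma bonferroni_card_UN:
  fixes A :: "'i \<Rightarrow> 'a set"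
  assumes "finite I" and "\<And>i. i \<in> I \<Longrightarrow> finite (A i)"
    and "\<And>i j. i \<in> I \<Longrightarrow> j \<in> I \<Longrightarrow> i \<noteq> j \<Longrightarrow> real (card (A i \<inter> A j)) \<le> K"
  shows "(\<Sum>i\<in>I. real (card (A i))) - K * (real (card I) * (real (card I) - 1) / 2)
    \<le> real (card (\<Union>i\<in>I. A i))"
  using assms
proof (induction I rule: finite_induct)
  case empty
  then show ?case by simp
next
  case (insert i I)
  let ?V = "\<Union>j\<in>I. A j"
  have fin: "finite ?V" "finite (A i)" using insert.hyps insert.prems by auto
  have IH: "(\<Sum>j\<in>I. real (card (A j))) - K * (real (card I) * (real (card I) - 1) / 2)
      \<le> real (card ?V)"
    using insert.prems by (intro insert.IH) auto
  \<comment> \<open>The new set meets the old union in at most |I| pieces, each of size at most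
    \<open>K\<close>. The loss |I| * K is exactly the growth of K * binomial(|I|, 2) when |I|
    increases by one.\<close>
  have "card (A i \<inter> ?V) \<le> (\<Sum>j\<in>I. card (A i \<inter> A j))"
    using card_UN_le[OF insert.hyps(1), of "\<lambda>j. A i \<inter> A j"] by simp
  then have "real (card (A i \<inter> ?V)) \<le> (\<Sum>j\<in>I. real (card (A i \<inter> A j)))"
    by (simp flip: of_nat_sum)
  also have "\<dots> \<le> (\<Sum>j\<in>I. K)"
    using insert.hyps insert.prems by (intro sum_mono) auto
  finally have inter: "real (card (A i \<inter> ?V)) \<le> real (card I) * K" by simp
  have "real (card (A i)) + real (card ?V) = real (card (A i \<union> ?V)) + real (card (A i \<inter> ?V))"
    using card_Un_Int[OF fin(2,1)] by (simp flip: of_nat_add)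
  with IH inter insert.hyps show ?case
    by (simp add: field_simps)
qed

section \<open>Counting functionals against the members of a partition\<close>

lemma partition_members_Int:
  assumes P: "vector_space_partition P" and "U \<in> P" "W \<in> P" "U \<noteq> W"
  shows "U \<inter> W = {0}"
proof -
  have "0 \<in> U" "0 \<in> W"
    using assms by (auto simp: vector_space_partition_def vec.subspace_0)
  moreover have "v = 0" if "v \<in> U" "v \<in> W" for v
    using assms that unfolding vector_space_partition_def by metis
  ultimately show ?thesis by auto
qed

lemma partition_bound:
  fixes P :: "('k::{field,finite} ^ 'n::finite) set set" and a :: int
  assumes q: "CARD('k) = q" and n: "CARD('n) = 2 * t"
    and P: "vector_space_partition P"
    and T: "int (card {U \<in> P. vec.dim U = t}) = int q ^ t + 1 - a"
    and d: "d < t"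
    and D: "x \<le> card {U \<in> P. vec.dim U = d}"
    and pos: "real x * (real q ^ (t - d) - 1) < real q ^ t - 1"
  shows "real x - R q t d x \<le> real_of_int a"
proof -
  define Ts where "Ts = {U \<in> P. vec.dim U = t}"
  \<comment> \<open>The nonzero functionals that vanish identically on no
    \<open>t\<close>-dimensional member.\<close>
  define M where "M = - {0} - (\<Union>U\<in>Ts. annihilator U - {0})"
  obtain Ds where Ds: "Ds \<subseteq> {U \<in> P. vec.dim U = d}" "card Ds = x"
    using obtain_subset_with_card_n[OF D] by metis
  define Q where "Q = real q ^ t"
  define r where "r = real q ^ (t - d)"
  have sub: "vec.subspace U" if "U \<in> P" for U
    using P that by (auto simp: vector_space_partition_def)
  have cT: "real (card Ts) = Q + 1 - a"
  proof -
    have "real_of_int (int (card Ts)) = real_of_int (int q ^ t + 1 - a)"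
      using T unfolding Ts_def by simp
    then show ?thesis by (simp add: Q_def)
  qed
  have card_Diff_0: "real (card (X - {0})) = real (card X) - 1"
    if "0 \<in> X" for X :: "('k ^ 'n) set"
  proof -
    have "card X > 0" using that by (auto simp: card_gt_0_iff)
    then show ?thesis using that by (simp add: card_Diff_singleton of_nat_diff)
  qed
  \<comment> \<open>The two dimensions add up to 2t, so the common annihilator has q^0 = 1
    element.\<close>
  have TT: "annihilator U \<inter> annihilator W = {0}" if "U \<in> Ts" "W \<in> Ts" "U \<noteq> W" for U W
  proof -
    have "card (annihilator U \<inter> annihilator W) = 1"
      using that card_annihilator_Int[OF sub sub partition_members_Int[OF P]] n
      by (auto simp: Ts_def)
    moreover have "0 \<in> annihilator U \<inter> annihilator W" by simp
    ultimately show ?thesis by (metis card_1_singletonE singletonD)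
  qed
  \<comment> \<open>By \<open>TT\<close> the annihilators of the members of \<open>Ts\<close> are
    disjoint away from 0, so their traces on \<open>X\<close> can be subtracted one by one while 0
    is removed once. This is applied to the whole space with c = q^t, and to the annihilator of a
    \<open>d\<close>-dimensional member with c = q^(t-d).\<close>
  have Int_M: "real (card (X \<inter> M)) = real (card X) - 1 - card Ts * (c - 1)"
    if X: "0 \<in> X" and c: "\<And>U. U \<in> Ts \<Longrightarrow> real (card (X \<inter> annihilator U)) = c"
    for X and c :: real
  proof -
    let ?Y = "\<Union>U\<in>Ts. X \<inter> annihilator U - {0}"
    have "card ?Y = (\<Sum>U\<in>Ts. card (X \<inter> annihilator U - {0}))"
      using TT by (intro card_UN_disjoint) auto
    then have "real (card ?Y) = (\<Sum>U\<in>Ts. real (card (X \<inter> annihilator U - {0})))"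
      by simp
    also have "\<dots> = card Ts * (c - 1)"
      using X c by (simp add: card_Diff_0 del: card_Diff_insert)
    finally have "real (card ?Y) = card Ts * (c - 1)" .
    moreover have "X \<inter> M = (X - {0}) - ?Y"
      by (auto simp: M_def)
    moreover have "real (card ((X - {0}) - ?Y)) = real (card (X - {0})) - real (card ?Y)"
    proof -
      have "?Y \<subseteq> X - {0}" by auto
      then show ?thesis by (simp add: card_Diff_subset card_mono of_nat_diff)
    qed
    ultimately show ?thesis by (simp only: card_Diff_0[OF X])
  qed
  have Qq: "real q ^ (2 * t) = Q * Q" "real q ^ (2 * t - d) = Q * r"
    "real q ^ (2 * t - 2 * d) = r * r"
    using d by (simp_all add: Q_def r_def mult_2 flip: power_add)
  have cM: "real (card M) = a * (Q - 1)"
  proof -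
    have "real (card (UNIV \<inter> M)) = real CARD('k ^ 'n) - 1 - card Ts * (Q - 1)"
      using sub n q by (intro Int_M) (auto simp: card_annihilator Ts_def Q_def)
    moreover have "real CARD('k ^ 'n) = Q * Q"
      using Qq n q by simp
    \<comment> \<open>Here Q^2 - 1 = (Q + 1)(Q - 1), so a full set of Q + 1 annihilators would leave
      nothing; each of the \<open>a\<close> missing ones leaves Q - 1 functionals.\<close>
    ultimately show ?thesis
      by (simp add: cT algebra_simps)
  qed
  have cD: "real (card (annihilator U \<inter> M)) = Q - 1 + (a - 1) * (r - 1)" if "U \<in> Ds" for U
  proof -
    have U: "U \<in> P" "vec.dim U = d" using that Ds by auto
    have "real (card (annihilator U \<inter> M)) = real (card (annihilator U)) - 1 - card Ts * (r - 1)"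
    proof (intro Int_M)
      fix W assume "W \<in> Ts"
      then have W: "W \<in> P" "vec.dim W = t" by (auto simp: Ts_def)
      with U d have "U \<inter> W = {0}" by (intro partition_members_Int[OF P]) auto
      from card_annihilator_Int[OF sub[OF U(1)] sub[OF W(1)] this]
      show "real (card (annihilator U \<inter> annihilator W)) = r"
        using U W d n q by (simp add: r_def)
    qed simp
    moreover have "real (card (annihilator U)) = Q * r"
      using U card_annihilator[OF sub[OF U(1)]] d n q Qq by simp
    ultimately show ?thesis
      by (simp add: cT algebra_simps)
  qed
  have DD: "real (card ((annihilator U \<inter> M) \<inter> (annihilator W \<inter> M))) \<le> r * r - 1"
    if "U \<in> Ds" "W \<in> Ds" "U \<noteq> W" for U W
  proof -
    have U: "U \<in> P" "vec.dim U = d" and W: "W \<in> P" "vec.dim W = d" using that Ds by auto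
    from card_annihilator_Int[OF sub[OF U(1)] sub[OF W(1)]
        partition_members_Int[OF P U(1) W(1) that(3)]]
    have "real (card (annihilator U \<inter> annihilator W)) = r * r"
      using U W d n q Qq by (simp add: mult_2)
    \<comment> \<open>The zero functional lies in both annihilators but not in \<open>M\<close>,
      which saves 1 in the bound.\<close>
    then have "real (card (annihilator U \<inter> annihilator W - {0})) = r * r - 1"
      by (simp add: card_Diff_0 del: card_Diff_insert)
    moreover have "card ((annihilator U \<inter> M) \<inter> (annihilator W \<inter> M))
        \<le> card (annihilator U \<inter> annihilator W - {0})"
      by (intro card_mono) (auto simp: M_def)
    ultimately show ?thesis by linarith
  qed
  have "(\<Sum>U\<in>Ds. real (card (annihilator U \<inter> M))) - (r * r - 1) * (real x * (real x - 1) / 2)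
      \<le> real (card (\<Union>U\<in>Ds. annihilator U \<inter> M))"
    using bonferroni_card_UN[of Ds "\<lambda>U. annihilator U \<inter> M" "r * r - 1"] DD Ds(2) by simp
  also have "\<dots> \<le> real (card M)"
    by (intro of_nat_mono card_mono) auto
  finally have "real x * (Q - 1 + (a - 1) * (r - 1)) - (r * r - 1) * (real x * (real x - 1) / 2)
      \<le> a * (Q - 1)"
    by (simp add: cD cM Ds(2))
  \<comment> \<open>Adding -x(x - 1)(r - 1) to both sides makes the left side factor; this is the
    origin of the summand 1 - q^(t-d) in \<open>R\<close>.\<close>
  then have "(real x - a) * (Q - 1 - real x * (r - 1))
      \<le> real x * (real x - 1) * (1 / 2 * (r * r - 1) + 1 - r)"
    by (simp add: field_simps)
  \<comment> \<open>This is the denominator of \<open>R\<close>; its positivity preserves the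
    direction of the inequality under division.\<close>
  moreover have "Q - 1 - real x * (r - 1) > 0"
    using pos by (simp add: Q_def r_def)
  ultimately have "real x - a
      \<le> real x * (real x - 1) * (1 / 2 * (r * r - 1) + 1 - r) / (Q - 1 - real x * (r - 1))"
    by (simp add: pos_le_divide_eq)
  also have "\<dots> = R q t d x"
    using Qq by (simp add: R_def Q_def r_def)
  finally show ?thesis by simp
qed

section \<open>The range of x permitted by \<open>mu\<close>\<close>

lemma mu_bounds:
  assumes "q \<ge> 2" "d < t" "x \<le> mu q t m d"
  shows "x \<le> m d" "real x * (real q ^ (t - d) - 1) < real q ^ t - 1"
proof -
  let ?B = "(real q ^ t - 1) / (real q ^ (t - d) - 1)"
  let ?X = "{0..m d} \<inter> {x. real x \<in> {0..<?B}}"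
  have r: "real q ^ (t - d) - 1 > 0" and "real q ^ t - 1 > 0"
    using assms by (simp_all add: one_less_power)
  \<comment> \<open>\<open>Max\<close> belongs to a finite set only if the set is nonempty, and 0 is
    a member because the quotient is positive. Both bounds then pass from the maximum to every
    smaller x; the half-open interval makes the second one strict.\<close>
  then have "0 \<in> ?X" by simp
  then have "mu q t m d \<in> ?X"
    unfolding mu_def by (intro Max_in) auto
  then have "mu q t m d \<le> m d" "real (mu q t m d) < ?B" by auto
  with assms(3) have "x \<le> m d" "real x < ?B" by linarith+
  with r show "x \<le> m d" "real x * (real q ^ (t - d) - 1) < real q ^ t - 1"
    by (simp_all add: pos_less_divide_eq)
qed

theorem theorem21:
  fixes P :: "('k::{field,finite} ^ 'n::finite) set set"
    and q t :: nat and a :: int and m :: "nat \<Rightarrow> nat"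
  defines "S \<equiv> (SIGMA d:{1..t - 1}. {1..mu q t m d})"
  assumes "primepow q" and "t \<ge> 2"
    and "CARD('k) = q" and "CARD('n) = 2 * t"
    and "vector_space_partition P"
    and "\<And>U. U \<in> P \<Longrightarrow> vec.dim U \<in> {1..t}"
    and "int (card {U \<in> P. vec.dim U = t}) = int q ^ t + 1 - a"
    and "\<And>d. d \<in> {1..t - 1} \<Longrightarrow> card {U \<in> P. vec.dim U = d} = m d"
  shows "S \<noteq> {} \<longrightarrow>
    real_of_int a \<ge> (MAX (d, x) \<in> S. real x - R q t d x)"
proof
  \<comment> \<open>\<open>Max\<close> of the empty set is unspecified, hence this guard;
    \<open>S\<close> is empty exactly when every \<open>mu q t m d\<close> in range is 0.\<close>
  assume "S \<noteq> {}"
  have "real x - R q t d x \<le> real_of_int a" if "(d, x) \<in> S" for d x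
  proof -
    have d: "d \<in> {1..t - 1}" "d < t" and x: "x \<le> mu q t m d"
      using that assms(3) by (auto simp: S_def)
    have "q \<ge> 2" using card_field_ge_2[where 'k = 'k] assms(4) by simp
    from mu_bounds[OF this d(2) x] show ?thesis
      using assms(9)[OF d(1)] d(2) by (intro partition_bound[OF assms(4,5,6,8)]) auto
  qed
  moreover have "finite S" by (simp add: S_def)
  ultimately show "real_of_int a \<ge> (MAX (d, x) \<in> S. real x - R q t d x)"
    using \<open>S \<noteq> {}\<close> by (subst Max_le_iff) auto
qed

end
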